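(* There exist a (non-bipartite) graph $G$ and preference orders such that the RDO algorithm satisfies $\mathbb{E}[|M|]\le 0.625\cdot|M^*|$, where $M$ is its output and $M^*$ a maximum matching of $G$. In particular, RDO is at most $0.625$-approximate on general graphs.
   Context: RDO: every vertex $u$ independently draws a rank $y_u$ uniformly from $[0,1]$; vertices are processed in ascending order of ranks; when $u$ is processed, if $u$ is unmatched and has an unmatched neighbor, it is matched to the unmatched neighbor first in its fixed preference order (an arbitrary strict total order over the other vertices, independent of the ranks). *)

theory Defs
  imports "HOL-Probability.Probability"
begin

definition finite_simple_graph :: "'v set \<Rightarrow> 'v set set \<Rightarrow> bool" where
  "finite_simple_graph V E \<longleftrightarrow>
     finite V \<and> (\<forall>e\<in>E. \<exists>u\<in>V. \<exists>v\<in>V. u \<noteq> v \<and> e = {u, v})"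

definition bipartite :: "'v set \<Rightarrow> 'v set set \<Rightarrow> bool" where
  "bipartite V E \<longleftrightarrow>
     (\<exists>A B. A \<union> B = V \<and> A \<inter> B = {} \<and> (\<forall>e\<in>E. \<exists>a\<in>A. \<exists>b\<in>B. e = {a, b}))"

definition matching :: "'v set set \<Rightarrow> 'v set set \<Rightarrow> bool" where
  "matching E M \<longleftrightarrow> M \<subseteq> E \<and> (\<forall>e\<in>M. \<forall>f\<in>M. e \<noteq> f \<longrightarrow> e \<inter> f = {})"

definition maximum_matching :: "'v set set \<Rightarrow> 'v set set \<Rightarrow> bool" where
  "maximum_matching E M \<longleftrightarrow> matching E M \<and> (\<forall>M'. matching E M' \<longrightarrow> card M' \<le> card M)"

(* (v, w) : pref u  means that u prefers v to w. *)
definition preference_orders :: "'v set \<Rightarrow> ('v \<Rightarrow> 'v rel) \<Rightarrow> bool" where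
  "preference_orders V pref \<longleftrightarrow>
     (\<forall>u\<in>V. pref u \<subseteq> (V - {u}) \<times> (V - {u}) \<and> strict_linear_order_on (V - {u}) (pref u))"

definition first_choice :: "'v rel \<Rightarrow> 'v set \<Rightarrow> 'v" where
  "first_choice r N = (THE v. v \<in> N \<and> (\<forall>w\<in>N - {v}. (v, w) \<in> r))"

definition unmatched_nbrs :: "'v set set \<Rightarrow> 'v set set \<Rightarrow> 'v \<Rightarrow> 'v set" where
  "unmatched_nbrs E M u = {v. {u, v} \<in> E \<and> v \<notin> \<Union>M}"

definition rdo_step ::
    "'v set set \<Rightarrow> ('v \<Rightarrow> 'v rel) \<Rightarrow> 'v \<Rightarrow> 'v set set \<Rightarrow> 'v set set" where
  "rdo_step E pref u M =
     (if u \<notin> \<Union>M \<and> unmatched_nbrs E M u \<noteq> {}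
      then insert {u, first_choice (pref u) (unmatched_nbrs E M u)} M
      else M)"

(* The matching output by RDO for the ranks y. Sorting is stable, so ties in the ranks
   (an event of probability zero) are broken by the order on the vertex type. *)
definition rdo ::
    "'v::linorder set \<Rightarrow> 'v set set \<Rightarrow> ('v \<Rightarrow> 'v rel) \<Rightarrow> ('v \<Rightarrow> real) \<Rightarrow> 'v set set" where
  "rdo V E pref y = fold (rdo_step E pref) (sort_key y (sorted_list_of_set V)) {}"

definition rank_space :: "'v set \<Rightarrow> ('v \<Rightarrow> real) measure" where
  "rank_space V = (\<Pi>\<^sub>M v\<in>V. uniform_measure lborel {0..1})"

(* Bochner integral; integrable_card_rdo below shows that it is never the default value 0
   of a non-integrable function. *)
definition rdo_expected_size ::
    "'v::linorder set \<Rightarrow> 'v set set \<Rightarrow> ('v \<Rightarrow> 'v rel) \<Rightarrow> real" where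
  "rdo_expected_size V E pref =
     prob_space.expectation (rank_space V) (\<lambda>y. real (card (rdo V E pref y)))"

(* Vertices are natural numbers, which covers every finite graph up to isomorphism. *)
definition rdo_approximate :: "real \<Rightarrow> bool" where
  "rdo_approximate c \<longleftrightarrow>
     (\<forall>(V :: nat set) E pref M.
        finite_simple_graph V E \<longrightarrow> preference_orders V pref \<longrightarrow> maximum_matching E M \<longrightarrow>
        c * real (card M) \<le> rdo_expected_size V E pref)"

lemma prob_space_rank_space: "prob_space (rank_space V)"
  unfolding rank_space_def
  by (intro prob_space_PiM prob_space_uniform_measure) auto

lemma measurable_insort_key:
  assumes "\<And>u. u \<in> insert x (set zs) \<Longrightarrow> (\<lambda>y. y u) \<in> borel_measurable (M :: ('v \<Rightarrow> real) measure)"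
  shows "(\<lambda>y. insort_key y x zs) \<in> measurable M (count_space UNIV)"
  using assms
proof (induction zs)
  case Nil
  then show ?case by simp
next
  case (Cons z zs)
  have [measurable]: "(\<lambda>y. y x) \<in> borel_measurable M" "(\<lambda>y. y z) \<in> borel_measurable M"
    using Cons.prems by auto
  have L: "(\<lambda>y. insort_key y x zs) \<in> measurable M (count_space UNIV)"
    by (rule Cons.IH) (use Cons.prems in auto)
  have [measurable]: "(\<lambda>y. z # insort_key y x zs) \<in> measurable M (count_space UNIV)"
    by (rule measurable_compose[OF L]) simp
  show ?case by simp
qed

lemma measurable_sort_key:
  fixes M :: "('v \<Rightarrow> real) measure"
  assumes "\<And>u. u \<in> set xs \<Longrightarrow> (\<lambda>y. y u) \<in> borel_measurable M"
  shows "(\<lambda>y. sort_key y xs) \<in> measurable M (count_space {zs. set zs = set xs \<and> length zs = length xs})"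
  using assms
proof (induction xs)
  case Nil
  then show ?case by simp
next
  case (Cons x xs)
  let ?A = "{zs. set zs = set xs \<and> length zs = length xs}"
  have fin: "finite ?A"
    by (rule finite_subset[OF _ finite_lists_length_eq[of "set xs" "length xs"]]) auto
  have "(\<lambda>y. insort_key y x (sort_key y xs)) \<in> measurable M (count_space UNIV)"
  proof (rule measurable_compose_countable'[where f = "\<lambda>zs y. insort_key y x zs" and I = ?A])
    show "(\<lambda>y. insort_key y x zs) \<in> measurable M (count_space UNIV)" if "zs \<in> ?A" for zs
      by (rule measurable_insort_key) (use that Cons.prems in auto)
    show "(\<lambda>y. sort_key y xs) \<in> measurable M (count_space ?A)"
      by (rule Cons.IH) (use Cons.prems in auto)
    show "countable ?A" using fin by (rule countable_finite)
  qed
  then show ?case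
    by (auto simp: measurable_def set_insort_key)
qed

lemma card_rdo_le: "card (fold (rdo_step E pref) xs M) \<le> card M + length xs"
proof (induction xs arbitrary: M)
  case Nil
  then show ?case by simp
next
  case (Cons x xs)
  have "card (rdo_step E pref x M) \<le> Suc (card M)"
    by (auto simp: rdo_step_def card_insert_le_m1 intro: card_insert_le_m1)
  with Cons.IH[of "rdo_step E pref x M"] show ?case by simp
qed

lemma integrable_card_rdo:
  assumes "finite V"
  shows "integrable (rank_space V) (\<lambda>y. real (card (rdo V E pref y)))"
proof -
  interpret prob_space "rank_space V" by (rule prob_space_rank_space)
  have m: "(\<lambda>y. sort_key y (sorted_list_of_set V)) \<in> measurable (rank_space V)
      (count_space {zs. set zs = set (sorted_list_of_set V) \<and> length zs = length (sorted_list_of_set V)})"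
  proof (rule measurable_sort_key)
    fix u assume "u \<in> set (sorted_list_of_set V)"
    then have "u \<in> V" using assms by simp
    then have "(\<lambda>y. y u) \<in> measurable (rank_space V) (uniform_measure lborel {0..1})"
      unfolding rank_space_def by (rule measurable_component_singleton)
    then show "(\<lambda>y. y u) \<in> borel_measurable (rank_space V)"
      by (simp cong: measurable_cong_sets)
  qed
  have "(\<lambda>y. real (card (rdo V E pref y))) \<in> borel_measurable (rank_space V)"
    unfolding rdo_def
    by (rule measurable_compose[OF m, where g = "\<lambda>zs. real (card (fold (rdo_step E pref) zs {}))"]) simp
  moreover have "AE y in rank_space V. norm (real (card (rdo V E pref y))) \<le> real (card V)"
    using card_rdo_le[of E pref _ "{}"] assms
    by (auto simp: rdo_def intro!: AE_I2) (metis add_0 length_sort length_sorted_list_of_set card.empty)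
  ultimately show ?thesis by (intro integrable_const_bound)
qed

end

theory Submission
  imports Defs
begin

text \<open>
  Take a triangle \<open>0, 1, 2\<close> with a pendant vertex \<open>3\<close> attached to \<open>0\<close>, and let every vertex prefer
  smaller neighbours. The maximum matching \<open>{03, 12}\<close> has two edges. Unless \<open>3\<close> is processed first,
  the first vertex gets matched along \<open>01\<close> or \<open>02\<close>, and that single edge already meets all edges.
  So the expected size is \<open>1 + 1/4 = 0.625 * 2\<close>.
\<close>

section \<open>The paw graph, its preferences and its maximum matching\<close>

definition paw_edges :: "nat set set" where
  "paw_edges = {{0,1}, {0,2}, {0,3}, {1,2}}"

text \<open>The relation depends on \<open>V\<close> because \<open>preference_orders\<close> asks
  for an order on all other vertices of \<open>V\<close>, neighbours or not, and for nothing beyond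
  \<open>V\<close>.\<close>

definition smaller_first :: "nat set \<Rightarrow> nat \<Rightarrow> nat rel" where
  "smaller_first V u = {(v, w). v \<in> V - {u} \<and> w \<in> V - {u} \<and> v < w}"

lemma preference_orders_smaller_first: "preference_orders V (smaller_first V)"
  unfolding preference_orders_def smaller_first_def strict_linear_order_on_def
  by (auto simp: trans_def irrefl_def total_on_def)

lemma first_choice_smaller_first:
  assumes "finite N" "N \<noteq> {}" "N \<subseteq> V - {u}"
  shows "first_choice (smaller_first V u) N = Min N"
  unfolding first_choice_def
proof (rule the_equality)
  have "Min N \<in> N" "Min N \<in> V - {u}" using Min_in assms by blast+
  then show "Min N \<in> N \<and> (\<forall>w\<in>N - {Min N}. (Min N, w) \<in> smaller_first V u)"
    using assms by (auto simp: smaller_first_def le_neq_implies_less)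
next
  fix v assume v: "v \<in> N \<and> (\<forall>w\<in>N - {v}. (v, w) \<in> smaller_first V u)"
  show "v = Min N"
    using v assms by (intro Min_eqI[symmetric]) (auto simp: smaller_first_def order.order_iff_strict)
qed

lemma finite_simple_graph_paw: "finite_simple_graph {0..3} paw_edges"
proof -
  have "{u, v} \<in> {e. \<exists>u\<in>{0..3}. \<exists>v\<in>{0..3}. u \<noteq> v \<and> e = {u, v}}"
    if "u \<le> 3" "v \<le> 3" "u \<noteq> v" for u v :: nat
    using that by (intro CollectI bexI[of _ u] bexI[of _ v]) auto
  then show ?thesis
    unfolding finite_simple_graph_def paw_edges_def by simp
qed

text \<open>The edges 01 and 02 force 1 and 2 onto the same side, against the edge 12.\<close>

lemma not_bipartite_paw: "\<not> bipartite V paw_edges"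
proof
  assume "bipartite V paw_edges"
  then obtain A B where AB: "A \<inter> B = {}" "\<forall>e\<in>paw_edges. \<exists>a\<in>A. \<exists>b\<in>B. e = {a, b}"
    unfolding bipartite_def by metis
  have "(x \<in> A \<and> y \<in> B) \<or> (y \<in> A \<and> x \<in> B)" if "{x, y} \<in> paw_edges" for x y
    using bspec[OF AB(2) that] by (auto simp: doubleton_eq_iff)
  from this[of 0 1] this[of 0 2] this[of 1 2] show False
    using AB(1) by (simp add: paw_edges_def) blast
qed

text \<open>The edges of a matching are pairwise disjoint two-element subsets of \<open>V\<close>;
  count their union.\<close>

lemma card_matching_le:
  assumes "finite_simple_graph V E" "matching E M"
  shows "2 * card M \<le> card V"
proof -
  have "finite V" using assms unfolding finite_simple_graph_def by blast
  have e: "e \<subseteq> V \<and> card e = 2" if e: "e \<in> M" for e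
  proof -
    have "e \<in> E" using assms e unfolding matching_def by blast
    then obtain u v where "u \<in> V" "v \<in> V" "u \<noteq> v" "e = {u, v}"
      using assms unfolding finite_simple_graph_def by blast
    then show ?thesis by simp
  qed
  have "card (\<Union>M) = (\<Sum>e\<in>M. card e)"
  proof (rule card_Union_disjoint)
    show "pairwise disjnt M"
      using assms unfolding matching_def pairwise_def disjnt_def by blast
    show "finite e" if "e \<in> M" for e
      using e[OF that] \<open>finite V\<close> finite_subset by blast
  qed
  also have "\<dots> = 2 * card M" using e by simp
  finally show ?thesis
    using card_mono[OF \<open>finite V\<close>, of "\<Union>M"] e by (simp add: Sup_le_iff)
qed

lemma maximum_matching_paw: "maximum_matching paw_edges {{0,3}, {1,2}}"
proof -
  have "matching paw_edges {{0,3}, {1,2}}"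
    by (auto simp: matching_def paw_edges_def)
  moreover have "card M \<le> 2" if "matching paw_edges M" for M
    using card_matching_le[OF finite_simple_graph_paw that] by simp
  moreover have "card {{0,3}, {1,2::nat}} = 2" by (simp add: doubleton_eq_iff)
  ultimately show ?thesis
    unfolding maximum_matching_def by metis
qed

section \<open>Runs of RDO on the paw\<close>

text \<open>Two unmatched endpoints would form an edge that \<open>M\<close> does not meet, so every
  step is idle. This freezes the run once 01 or 02 is chosen.\<close>

lemma fold_rdo_step_maximal:
  assumes "\<And>e. e \<in> E \<Longrightarrow> e \<inter> \<Union>M \<noteq> {}"
  shows "fold (rdo_step E pref) xs M = M"
proof -
  have "unmatched_nbrs E M u = {}" if "u \<notin> \<Union>M" for u
    using that unfolding unmatched_nbrs_def by (blast dest: assms)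
  then have "rdo_step E pref u M = M" for u
    unfolding rdo_step_def by metis
  then show ?thesis by (induction xs) auto
qed

lemma rdo_step_paw:
  assumes "unmatched_nbrs paw_edges M u \<subseteq> {0..3} - {u}"
  shows "rdo_step paw_edges (smaller_first {0..3}) u M =
    (if u \<notin> \<Union>M \<and> unmatched_nbrs paw_edges M u \<noteq> {}
     then insert {u, Min (unmatched_nbrs paw_edges M u)} M else M)"
  unfolding rdo_step_def
  using first_choice_smaller_first[OF finite_subset[OF assms] _ assms] by simp

lemma unmatched_nbrs_paw:
  "unmatched_nbrs paw_edges M u =
     (if u = 0 then {1,2,3} else if u = 1 then {0,2} else if u = 2 then {0,1}
      else if u = 3 then {0} else {}) - \<Union>M"
  by (auto simp: unmatched_nbrs_def paw_edges_def doubleton_eq_iff split: if_splits)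

text \<open>The two listed matchings form an invariant: once 03 is matched, 12 is the only edge that
  can still be added.\<close>

lemma card_fold_paw_pendant_first:
  assumes "M \<in> {{{0,3}}, {{0,3}, {1,2}}}"
  shows "card (fold (rdo_step paw_edges (smaller_first {0..3})) xs M) \<le> 2"
  using assms
proof (induction xs arbitrary: M)
  case Nil
  then show ?case by (auto simp: doubleton_eq_iff)
next
  case (Cons u xs)
  have "rdo_step paw_edges (smaller_first {0..3}) u M \<in> {{{0,3}}, {{0,3}, {1,2}}}"
  proof -
    \<comment> \<open>Only 1 and 2 can act, and only while 12 is absent; every other step is
      idle.\<close>
    consider "M = {{0,3}}" "u = 1" | "M = {{0,3}}" "u = 2"
      | "u \<in> \<Union>M \<or> unmatched_nbrs paw_edges M u = {}"
      using Cons.prems by (fastforce simp: unmatched_nbrs_paw)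
    then show ?thesis
    proof cases
      case 1
      then have "unmatched_nbrs paw_edges M u = {2}" by (auto simp: unmatched_nbrs_paw)
      then show ?thesis using 1 by (subst rdo_step_paw) auto
    next
      case 2
      then have "unmatched_nbrs paw_edges M u = {1}" by (auto simp: unmatched_nbrs_paw)
      then show ?thesis using 2 by (subst rdo_step_paw) auto
    next
      case 3
      then have "rdo_step paw_edges (smaller_first {0..3}) u M = M"
        unfolding rdo_step_def by metis
      then show ?thesis using Cons.prems by simp
    qed
  qed
  then show ?case using Cons.IH by simp
qed

lemma card_fold_paw_le:
  assumes "u \<in> {0..3}"
  shows "card (fold (rdo_step paw_edges (smaller_first {0..3})) (u # xs) {}) \<le> (if u = 3 then 2 else 1)"
proof -
  let ?step = "rdo_step paw_edges (smaller_first {0..3})"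
  \<comment> \<open>With nothing matched, 0 takes its smallest neighbour 1, while 1, 2 and 3 each
    take 0.\<close>
  have step: "?step u {} = {{u, if u = 0 then 1 else 0}}"
    using assms by (subst rdo_step_paw) (auto simp: unmatched_nbrs_paw)
  show ?thesis
  proof (cases "u = 3")
    case True
    then show ?thesis
      using step card_fold_paw_pendant_first[of "{{0,3}}" xs] by (simp add: insert_commute)
  next
    case False
    then have "fold ?step xs {{u, if u = 0 then 1 else 0}} = {{u, if u = 0 then 1 else 0}}"
      using assms by (intro fold_rdo_step_maximal) (auto simp: paw_edges_def)
    then show ?thesis using step False by simp
  qed
qed

lemma sort_key_eq_Cons_le:
  assumes "sort_key f xs = u # zs" "x \<in> set xs"
  shows "f u \<le> f x"
proof -
  have "sorted (map f (u # zs))"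
    unfolding assms(1)[symmetric] by (rule sorted_sort_key)
  moreover have "x \<in> set (u # zs)"
    using assms by (metis set_sort)
  ultimately show ?thesis by auto
qed

text \<open>The non-strict inequalities make the bound hold pointwise, ties included: whenever 3
  heads the sorted list, its rank is minimal and the indicator is 1.\<close>

lemma card_rdo_paw_le:
  "real (card (rdo {0..3} paw_edges (smaller_first {0..3}) y))
     \<le> 1 + indicator {y. \<forall>v\<in>{0,1,2}. y 3 \<le> y v} y"
proof -
  let ?xs = "sorted_list_of_set {0..3::nat}"
  have set: "set (sort_key y ?xs) = {0..3}" by simp
  then have "sort_key y ?xs \<noteq> []"
    by (metis atLeastatMost_empty_iff2 list.set(1) zero_le)
  then obtain u zs where uzs: "sort_key y ?xs = u # zs"
    by (meson list.exhaust)
  have "u \<in> {0..3}"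
    using set unfolding uzs by auto
  note le = card_fold_paw_le[OF this, of zs]
  show ?thesis
  proof (cases "u = 3")
    case True
    then have "y 3 \<le> y v" if "v \<in> {0,1,2}" for v
      using sort_key_eq_Cons_le[OF uzs, of v] that by auto
    then show ?thesis using le True by (simp add: rdo_def uzs indicator_def)
  next
    case False
    then show ?thesis using le by (simp add: rdo_def uzs indicator_def)
  qed
qed

section \<open>Probability that a given rank is smallest\<close>

lemma nn_integral_one_minus_power:
  "(\<integral>\<^sup>+x. ennreal ((1 - x) ^ n) * indicator {0..1} x \<partial>lborel) = ennreal (1 / real (Suc n))"
proof -
  have "(\<integral>\<^sup>+x. ennreal ((1 - x) ^ n) * indicator {0..1} x \<partial>lborel)
      = ennreal (- ((1 - 1) ^ Suc n) / real (Suc n) - (- ((1 - 0) ^ Suc n) / real (Suc n)))"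
    by (rule nn_integral_FTC_Icc)
       (auto intro!: derivative_eq_intros simp del: power_Suc of_nat_Suc)
  then show ?thesis by simp
qed

text \<open>By Fubini, fix the rank \<open>x\<close> of \<open>i\<close>: the other ranks
  independently lie in \<open>{x..}\<close>, which for \<open>x\<close> in [0,1] has probability
  \<open>(1 - x) ^ card I\<close>. Then integrate over \<open>x\<close>.\<close>

lemma emeasure_rank_space_first:
  fixes i :: 'v
  assumes I: "finite I" "i \<notin> I"
  shows "emeasure (rank_space (insert i I)) {y \<in> space (rank_space (insert i I)). \<forall>v\<in>I. y i \<le> y v}
         = ennreal (1 / real (Suc (card I)))"
proof -
  let ?U = "uniform_measure lborel {0..1::real}"
  let ?P = "rank_space (insert i I)"
  let ?A = "{y \<in> space ?P. \<forall>v\<in>I. y i \<le> y v}"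
  have U: "prob_space ?U" by (intro prob_space_uniform_measure) auto
  interpret product_sigma_finite "\<lambda>_::'v. ?U"
    by (rule product_sigma_finite.intro) (intro prob_space_imp_sigma_finite U)
  have meas: "(\<lambda>y. y v) \<in> borel_measurable ?P" if "v \<in> insert i I" for v
    using measurable_component_singleton[OF that, of "\<lambda>_. ?U"]
    by (simp add: rank_space_def cong: measurable_cong_sets)
  have A: "?A \<in> sets ?P"
    using I meas by (intro sets.sets_Collect_finite_All borel_measurable_le) auto
  \<comment> \<open>Valid for every real \<open>x\<close>: \<open>max\<close> covers negative
    \<open>x\<close>, and for \<open>x\<close> above 1 \<open>ennreal\<close> sends the negative
    argument to 0.\<close>
  have tail: "emeasure ?U {x..} = ennreal (1 - max 0 x)" for x
  proof -
    have "{0..1} \<inter> {x..} = {max 0 x..1}" by auto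
    then show ?thesis by (simp add: divide_ennreal_def emeasure_lborel_Icc_eq ennreal_neg)
  qed
  have "emeasure ?P ?A = (\<integral>\<^sup>+y. indicator ?A y \<partial>?P)"
    using A by simp
  also have "\<dots> = (\<integral>\<^sup>+x. (\<integral>\<^sup>+y. indicator ?A (y(i := x)) \<partial>Pi\<^sub>M I (\<lambda>_. ?U)) \<partial>?U)"
    unfolding rank_space_def
    by (rule product_nn_integral_insert_rev[OF I])
       (use A in \<open>simp add: rank_space_def\<close>)
  also have "\<dots> = (\<integral>\<^sup>+x. emeasure ?U {x..} ^ card I \<partial>?U)"
  proof (rule nn_integral_cong)
    fix x :: real
    \<comment> \<open>For fixed \<open>x\<close> the section of the event is a box, whose measure is
      a product of one-dimensional ones.\<close>
    have "(\<integral>\<^sup>+y. indicator ?A (y(i := x)) \<partial>Pi\<^sub>M I (\<lambda>_. ?U))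
        = (\<integral>\<^sup>+y. indicator (Pi\<^sub>E I (\<lambda>_. {x..})) y \<partial>Pi\<^sub>M I (\<lambda>_. ?U))"
      using I by (intro nn_integral_cong)
        (auto simp: indicator_def space_PiM rank_space_def PiE_iff extensional_def split: if_splits)
    also have "\<dots> = emeasure (Pi\<^sub>M I (\<lambda>_. ?U)) (Pi\<^sub>E I (\<lambda>_. {x..}))"
      using I by (intro nn_integral_indicator sets_PiM_I_finite) auto
    also have "\<dots> = emeasure ?U {x..} ^ card I"
      using I by (subst emeasure_PiM) auto
    finally show "(\<integral>\<^sup>+y. indicator ?A (y(i := x)) \<partial>Pi\<^sub>M I (\<lambda>_. ?U)) = emeasure ?U {x..} ^ card I" .
  qed
  also have "\<dots> = (\<integral>\<^sup>+x. emeasure ?U {x..} ^ card I * indicator {0..1} x \<partial>lborel)"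
  proof (subst nn_integral_uniform_measure)
    show "(\<lambda>x. emeasure ?U {x..} ^ card I) \<in> borel_measurable lborel"
      unfolding tail by measurable
  qed (auto simp: divide_ennreal_def)
  also have "\<dots> = (\<integral>\<^sup>+x. ennreal ((1 - x) ^ card I) * indicator {0..1} x \<partial>lborel)"
    by (intro nn_integral_cong) (auto simp: tail ennreal_power split: split_indicator)
  finally show ?thesis by (simp add: nn_integral_one_minus_power)
qed

section \<open>Expected size on the paw and the resulting bound\<close>

lemma rdo_expected_size_paw: "rdo_expected_size {0..3} paw_edges (smaller_first {0..3}) \<le> 5/4"
proof -
  let ?P = "rank_space {0..3::nat}"
  let ?A = "{y. \<forall>v\<in>{0,1,2::nat}. y 3 \<le> (y v :: real)}"
  have ins: "{0..3::nat} = insert 3 {0,1,2}" by auto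
  interpret prob_space ?P by (rule prob_space_rank_space)
  have eq: "?A \<inter> space ?P = {y \<in> space ?P. \<forall>v\<in>{0,1,2}. y 3 \<le> y v}" by auto
  \<comment> \<open>Vertex 3 competes with three others, hence 1/(3+1).\<close>
  have em: "emeasure ?P (?A \<inter> space ?P) = ennreal (1/4)"
    unfolding eq unfolding ins by (subst emeasure_rank_space_first) auto
  \<comment> \<open>\<open>emeasure\<close> is 0 outside the sigma-algebra, so a nonzero value
    already yields measurability.\<close>
  then have sets: "?A \<inter> space ?P \<in> events"
    by (intro emeasure_neq_0_sets) auto
  have int: "integrable ?P (indicator (?A \<inter> space ?P) :: _ \<Rightarrow> real)"
    using sets by (simp add: less_top[symmetric])
  have "rdo_expected_size {0..3} paw_edges (smaller_first {0..3})
      \<le> expectation (\<lambda>y. 1 + indicator (?A \<inter> space ?P) y)"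
    unfolding rdo_expected_size_def
  proof (rule integral_mono)
    show "real (card (rdo {0..3} paw_edges (smaller_first {0..3}) y)) \<le> 1 + indicator (?A \<inter> space ?P) y"
      if "y \<in> space ?P" for y
      using card_rdo_paw_le[of y] that by (simp add: indicator_def)
  qed (use int in \<open>auto intro: integrable_card_rdo\<close>)
  also have "\<dots> = 1 + prob (?A \<inter> space ?P)"
    using int by (subst Bochner_Integration.integral_add) (auto simp: prob_space Int_assoc)
  also have "prob (?A \<inter> space ?P) = 1/4"
    using em by (simp add: measure_def)
  finally show ?thesis by simp
qed

theorem theorem4:
  shows "(\<exists>(V :: nat set) E pref Mstar.
            finite_simple_graph V E \<and> \<not> bipartite V E \<and> preference_orders V pref \<and>
            maximum_matching E Mstar \<and>
            rdo_expected_size V E pref \<le> 0.625 * real (card Mstar))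
         \<and> (\<forall>c. rdo_approximate c \<longrightarrow> c \<le> 0.625)"
proof (intro conjI allI impI)
  have card: "card {{0,3}, {1,2::nat}} = 2" by (simp add: doubleton_eq_iff)
  show "\<exists>(V :: nat set) E pref Mstar.
            finite_simple_graph V E \<and> \<not> bipartite V E \<and> preference_orders V pref \<and>
            maximum_matching E Mstar \<and>
            rdo_expected_size V E pref \<le> 0.625 * real (card Mstar)"
    using finite_simple_graph_paw not_bipartite_paw preference_orders_smaller_first
      maximum_matching_paw rdo_expected_size_paw card
    by (intro exI[of _ "{0..3}"] exI[of _ paw_edges] exI[of _ "smaller_first {0..3}"]
        exI[of _ "{{0,3}, {1,2}}"]) simp
  fix c assume "rdo_approximate c"
  \<comment> \<open>On the paw the guarantee reads 2c \<le> 5/4.\<close>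
  then have "c * real (card {{0,3}, {1,2::nat}})
      \<le> rdo_expected_size {0..3} paw_edges (smaller_first {0..3})"
    using finite_simple_graph_paw preference_orders_smaller_first maximum_matching_paw
    unfolding rdo_approximate_def by blast
  then show "c \<le> 0.625" using rdo_expected_size_paw card by simp
qed

end
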